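(* The number of pairwise nonequivalent $d$-dimensional extremal $(0,1)$-matrices of order $n$ is not greater than $n^{nd(d-1)}+1$.
   Context: A $d$-dimensional $(0,1)$-matrix $A$ of order $n$ is an array $(a_\alpha)_{\alpha\in I_n^d}$ with $a_\alpha\in\{0,1\}$, where $I_n^d=\{(\alpha_1,\ldots,\alpha_d):\alpha_i\in\{0,\ldots,n-1\}\}$. Its support is the set of $\alpha$ with $a_\alpha=1$. The hyperplane $\Gamma_{i,j}$ of direction $i$ is $\{\alpha:\alpha_i=j\}$; hyperplanes of the same direction are parallel. Two matrices are equivalent if one can be turned into the other by permutations of parallel hyperplanes (independently in each direction) and permutations of the directions (transpositions). The number of nonequivalent matrices means the number of equivalence classes. A polydiagonal in $A$ is an assignment of nonnegative real weights to the entries of the support of $A$ such that the sum of the weights over each hyperplane equals $1$. The matrix $A$ is extremal if $A$ has no polydiagonal, and after adding any new index to the support of $A$ the resulting matrix has a polydiagonal. *)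

theory Defs
  imports Complex_Main "HOL-Library.FuncSet" "HOL-Combinatorics.Permutations"
begin

text \<open>Directions are numbered \<open>0, \<dots>, d - 1\<close>. Indices and matrices are extensional functions
  (\<open>undefined\<close> outside their domain), so that equality of matrices is equality of functions.\<close>

definition index_set :: "nat \<Rightarrow> nat \<Rightarrow> (nat \<Rightarrow> nat) set" where
  "index_set d n = {..<d} \<rightarrow>\<^sub>E {..<n}"

definition zero_one_matrices :: "nat \<Rightarrow> nat \<Rightarrow> ((nat \<Rightarrow> nat) \<Rightarrow> nat) set" where
  "zero_one_matrices d n = index_set d n \<rightarrow>\<^sub>E {0, 1}"

definition supp :: "nat \<Rightarrow> nat \<Rightarrow> ((nat \<Rightarrow> nat) \<Rightarrow> nat) \<Rightarrow> (nat \<Rightarrow> nat) set" where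
  "supp d n A = {\<alpha> \<in> index_set d n. A \<alpha> = 1}"

definition hyperplane :: "nat \<Rightarrow> nat \<Rightarrow> nat \<Rightarrow> nat \<Rightarrow> (nat \<Rightarrow> nat) set" where
  "hyperplane d n i j = {\<alpha> \<in> index_set d n. \<alpha> i = j}"

text \<open>Only the values of \<open>w\<close> on the support matter.\<close>

definition polydiagonal ::
  "nat \<Rightarrow> nat \<Rightarrow> ((nat \<Rightarrow> nat) \<Rightarrow> nat) \<Rightarrow> ((nat \<Rightarrow> nat) \<Rightarrow> real) \<Rightarrow> bool" where
  "polydiagonal d n A w \<longleftrightarrow>
     (\<forall>\<alpha>\<in>supp d n A. 0 \<le> w \<alpha>) \<and>
     (\<forall>i<d. \<forall>j<n. (\<Sum>\<alpha>\<in>hyperplane d n i j \<inter> supp d n A. w \<alpha>) = 1)"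

definition has_polydiagonal :: "nat \<Rightarrow> nat \<Rightarrow> ((nat \<Rightarrow> nat) \<Rightarrow> nat) \<Rightarrow> bool" where
  "has_polydiagonal d n A \<longleftrightarrow> (\<exists>w. polydiagonal d n A w)"

definition extremal_matrices :: "nat \<Rightarrow> nat \<Rightarrow> ((nat \<Rightarrow> nat) \<Rightarrow> nat) set" where
  "extremal_matrices d n =
     {A \<in> zero_one_matrices d n.
        \<not> has_polydiagonal d n A \<and>
        (\<forall>\<alpha>\<in>index_set d n - supp d n A. has_polydiagonal d n (A(\<alpha> := 1)))}"

text \<open>\<open>\<tau>\<close> permutes the directions, and \<open>\<sigma> i\<close> permutes the parallel hyperplanes of direction \<open>i\<close>.
  Every composition of such operations has this normal form.\<close>

definition act_index :: "nat \<Rightarrow> (nat \<Rightarrow> nat) \<Rightarrow> (nat \<Rightarrow> nat \<Rightarrow> nat) \<Rightarrow> (nat \<Rightarrow> nat) \<Rightarrow> nat \<Rightarrow> nat" where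
  "act_index d \<tau> \<sigma> \<alpha> = (\<lambda>i\<in>{..<d}. \<sigma> i (\<alpha> (\<tau> i)))"

definition matrix_equiv ::
  "nat \<Rightarrow> nat \<Rightarrow> (((nat \<Rightarrow> nat) \<Rightarrow> nat) \<times> ((nat \<Rightarrow> nat) \<Rightarrow> nat)) set" where
  "matrix_equiv d n =
     {(A, B). A \<in> zero_one_matrices d n \<and> B \<in> zero_one_matrices d n \<and>
        (\<exists>\<tau> \<sigma>. \<tau> permutes {..<d} \<and> (\<forall>i<d. \<sigma> i permutes {..<n}) \<and>
           (\<forall>\<alpha>\<in>index_set d n. B \<alpha> = A (act_index d \<tau> \<sigma> \<alpha>)))}"

lemma finite_zero_one_matrices: "finite (zero_one_matrices d n)"
  unfolding zero_one_matrices_def index_set_def by (intro finite_PiE) auto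

lemma finite_extremal_matrices: "finite (extremal_matrices d n)"
  by (rule finite_subset[OF _ finite_zero_one_matrices[of d n]]) (auto simp: extremal_matrices_def)

lemma act_index_in:
  assumes "\<tau> permutes {..<d}" "\<forall>i<d. \<sigma> i permutes {..<n}" "\<alpha> \<in> index_set d n"
  shows "act_index d \<tau> \<sigma> \<alpha> \<in> index_set d n"
proof -
  have "\<sigma> i (\<alpha> (\<tau> i)) < n" if "i < d" for i
  proof -
    have "\<tau> i < d" using permutes_in_image[OF assms(1), of i] that by simp
    then have "\<alpha> (\<tau> i) < n" using assms(3) by (auto simp: index_set_def)
    then show ?thesis using permutes_in_image[of "\<sigma> i" "{..<n}" "\<alpha> (\<tau> i)"] assms(2) that by simp
  qed
  then show ?thesis by (auto simp: act_index_def index_set_def)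
qed

lemma equiv_matrix_equiv: "equiv (zero_one_matrices d n) (matrix_equiv d n)"
proof (rule equivI)
  show "matrix_equiv d n \<subseteq> zero_one_matrices d n \<times> zero_one_matrices d n"
    by (auto simp: matrix_equiv_def)
  show "refl_on (zero_one_matrices d n) (matrix_equiv d n)"
  proof (rule refl_onI)
    fix A assume A: "A \<in> zero_one_matrices d n"
    have "act_index d id (\<lambda>_. id) \<alpha> = \<alpha>" if "\<alpha> \<in> index_set d n" for \<alpha>
      using that by (auto simp: act_index_def index_set_def PiE_def extensional_def fun_eq_iff)
    then have "\<exists>\<tau> \<sigma>. \<tau> permutes {..<d} \<and> (\<forall>i<d. \<sigma> i permutes {..<n}) \<and>
           (\<forall>\<alpha>\<in>index_set d n. A \<alpha> = A (act_index d \<tau> \<sigma> \<alpha>))"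
      by (intro exI[of _ id] exI[of _ "\<lambda>_. id"]) (simp add: permutes_id)
    then show "(A, A) \<in> matrix_equiv d n" using A by (simp add: matrix_equiv_def)
  qed
  show "sym (matrix_equiv d n)"
  proof (rule symI)
    fix A B assume "(A, B) \<in> matrix_equiv d n"
    then obtain \<tau> \<sigma> where AB: "A \<in> zero_one_matrices d n" "B \<in> zero_one_matrices d n"
      and t: "\<tau> permutes {..<d}" and s: "\<forall>i<d. \<sigma> i permutes {..<n}"
      and eq: "\<forall>\<alpha>\<in>index_set d n. B \<alpha> = A (act_index d \<tau> \<sigma> \<alpha>)"
      by (auto simp: matrix_equiv_def)
    define \<tau>' where "\<tau>' = inv \<tau>"
    define \<sigma>' where "\<sigma>' = (\<lambda>i. inv (\<sigma> (\<tau>' i)))"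
    have t': "\<tau>' permutes {..<d}" unfolding \<tau>'_def by (rule permutes_inv[OF t])
    have lt: "\<tau>' i < d" if "i < d" for i using permutes_in_image[OF t', of i] that by simp
    have lt0: "\<tau> i < d" if "i < d" for i using permutes_in_image[OF t, of i] that by simp
    have s': "\<forall>i<d. \<sigma>' i permutes {..<n}"
      unfolding \<sigma>'_def using s lt by (auto intro: permutes_inv)
    have "act_index d \<tau> \<sigma> (act_index d \<tau>' \<sigma>' \<alpha>) = \<alpha>" if "\<alpha> \<in> index_set d n" for \<alpha>
    proof
      fix i
      show "act_index d \<tau> \<sigma> (act_index d \<tau>' \<sigma>' \<alpha>) i = \<alpha> i"
      proof (cases "i < d")
        case True
        have "\<tau>' (\<tau> i) = i" unfolding \<tau>'_def using permutes_inverses(2)[OF t] by simp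
        then show ?thesis using True lt0[OF True] permutes_inverses(1)[of "\<sigma> i" "{..<n}"] s
          by (simp add: act_index_def \<sigma>'_def)
      next
        case False
        then show ?thesis using that by (auto simp: act_index_def index_set_def PiE_def extensional_def)
      qed
    qed
    then have "\<forall>\<alpha>\<in>index_set d n. A \<alpha> = B (act_index d \<tau>' \<sigma>' \<alpha>)"
      using eq act_index_in[OF t' s'] by simp
    then show "(B, A) \<in> matrix_equiv d n" using AB t' s' by (auto simp: matrix_equiv_def)
  qed
  show "trans (matrix_equiv d n)"
  proof (rule transI)
    fix A B C assume "(A, B) \<in> matrix_equiv d n" "(B, C) \<in> matrix_equiv d n"
    then obtain \<tau> \<sigma> \<tau>' \<sigma>' where AC: "A \<in> zero_one_matrices d n" "C \<in> zero_one_matrices d n"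
      and t: "\<tau> permutes {..<d}" "\<tau>' permutes {..<d}"
      and s: "\<forall>i<d. \<sigma> i permutes {..<n}" "\<forall>i<d. \<sigma>' i permutes {..<n}"
      and eq: "\<forall>\<alpha>\<in>index_set d n. B \<alpha> = A (act_index d \<tau> \<sigma> \<alpha>)"
         "\<forall>\<alpha>\<in>index_set d n. C \<alpha> = B (act_index d \<tau>' \<sigma>' \<alpha>)"
      by (auto simp: matrix_equiv_def)
    have lt: "\<tau> i < d" if "i < d" for i using permutes_in_image[OF t(1), of i] that by simp
    have "act_index d \<tau> \<sigma> (act_index d \<tau>' \<sigma>' \<alpha>) = act_index d (\<tau>' \<circ> \<tau>) (\<lambda>i. \<sigma> i \<circ> \<sigma>' (\<tau> i)) \<alpha>" for \<alpha>
      using lt by (auto simp: act_index_def fun_eq_iff)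
    then have "\<forall>\<alpha>\<in>index_set d n. C \<alpha> = A (act_index d (\<tau>' \<circ> \<tau>) (\<lambda>i. \<sigma> i \<circ> \<sigma>' (\<tau> i)) \<alpha>)"
      using eq act_index_in[OF t(2) s(2)] by simp
    moreover have "(\<tau>' \<circ> \<tau>) permutes {..<d}" by (rule permutes_compose[OF t])
    moreover have "\<forall>i<d. (\<sigma> i \<circ> \<sigma>' (\<tau> i)) permutes {..<n}"
      using s lt by (auto intro: permutes_compose)
    ultimately show "(A, C) \<in> matrix_equiv d n" using AC
      unfolding matrix_equiv_def mem_Collect_eq prod.case
      by (intro conjI exI[of _ "\<tau>' \<circ> \<tau>"] exI[of _ "\<lambda>i. \<sigma> i \<circ> \<sigma>' (\<tau> i)"])
  qed
qed

end

theory Submission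
  imports Defs
begin

text \<open>By Farkas' lemma, \<open>A\<close> has no polydiagonal iff there is a certificate: reals \<open>z\<^sub>i\<^sub>j\<close> with positive
  total and \<open>\<Sum>\<^sub>i z (i, \<alpha>\<^sub>i) \<le> 0\<close> for all \<open>\<alpha>\<close> in the support. If \<open>A\<close> is extremal, then the support is
  exactly the set where any certificate is nonpositive. Choose a certificate with a maximal set \<open>T\<close>
  of tight support indices. Then every \<open>z\<close> with positive total that vanishes on \<open>T\<close> is again a
  certificate, since otherwise moving in the direction \<open>z\<close> would produce more tight indices. So \<open>T\<close>,
  and even a minimal subset \<open>B\<close> of \<open>T\<close> imposing the same linear equations, determines \<open>A\<close>. The vectors
  of \<open>B\<close> are linearly independent, hence can be assigned to distinct hyperplanes containing them.
  If no hyperplane avoids the support, each of the remaining hyperplanes contains an index of \<open>T\<close> as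
  well, so \<open>A\<close> is encoded by choosing one index in each of the \<open>nd\<close> hyperplanes, each of which has
  \<open>n\<^bsup>d-1\<^esup>\<close> elements. The extremal matrices whose support avoids a hyperplane vanish exactly on this
  hyperplane and form at most one equivalence class.\<close>

section \<open>Dot products over a finite set and Farkas' lemma\<close>

definition dot :: "'x set \<Rightarrow> ('x \<Rightarrow> real) \<Rightarrow> ('x \<Rightarrow> real) \<Rightarrow> real" where
  "dot X y v = (\<Sum>x\<in>X. y x * v x)"

lemma dot_add_scale_left: "dot X (\<lambda>x. y x + c * z x) v = dot X y v + c * dot X z v"
  by (simp add: dot_def algebra_simps sum.distrib sum_distrib_left)

lemma dot_add_scale_right: "dot X y (\<lambda>x. u x + c * v x) = dot X y u + c * dot X y v"
  by (simp add: dot_def algebra_simps sum.distrib sum_distrib_left)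

lemma dot_scale_left: "dot X (\<lambda>x. c * y x) v = c * dot X y v"
  by (simp add: dot_def algebra_simps sum_distrib_left)

lemma dot_sum_right: "dot X y (\<lambda>x. \<Sum>i\<in>I. u i * a i x) = (\<Sum>i\<in>I. u i * dot X y (a i))"
  unfolding dot_def sum_distrib_left by (subst sum.swap) (simp add: mult_ac)

lemma dot_unit:
  assumes "finite X" "x \<in> X"
  shows "dot X (\<lambda>t. if t = x then 1 else 0) v = v x"
  using assms by (simp add: dot_def if_distrib[of "\<lambda>t. t * _"] cong: if_cong)

text \<open>Induction on the number of functionals (Bartl): if \<open>a k\<close> is needed, there is \<open>y'\<close> violating the
  implication without \<open>a k\<close>, normalised by \<open>a k \<cdot> y' = 1\<close>, and all functionals are composed with the
  projection \<open>y - (a k \<cdot> y) y'\<close>.\<close>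

lemma farkas:
  assumes "finite I" "finite X"
    and "\<And>y. \<forall>i\<in>I. dot X y (a i) \<le> 0 \<Longrightarrow> dot X y b \<le> 0"
  shows "\<exists>u. (\<forall>i\<in>I. 0 \<le> u i) \<and> (\<forall>x\<in>X. b x = (\<Sum>i\<in>I. u i * a i x))"
  using assms(1,3)
proof (induction I arbitrary: a b rule: finite_induct)
  case empty
  have "dot X b b \<le> 0" using empty by simp
  moreover have "dot X b b \<ge> 0" unfolding dot_def by (intro sum_nonneg) simp
  ultimately have "\<forall>x\<in>X. b x * b x = 0"
    unfolding dot_def by (subst sum_nonneg_eq_0_iff[symmetric]) (auto simp: assms(2))
  then show ?case by auto
next
  case (insert k I)
  show ?case
  proof (cases "\<forall>y. (\<forall>i\<in>I. dot X y (a i) \<le> 0) \<longrightarrow> dot X y b \<le> 0")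
    case True
    then obtain u where u: "\<forall>i\<in>I. 0 \<le> u i" "\<forall>x\<in>X. b x = (\<Sum>i\<in>I. u i * a i x)"
      using insert.IH[of a b] by blast
    have "(\<Sum>i\<in>I. (u(k := 0)) i * a i x) = (\<Sum>i\<in>I. u i * a i x)" for x
      using insert.hyps by (intro sum.cong) auto
    then show ?thesis
      using u insert.hyps by (intro exI[of _ "u(k := 0)"]) auto
  next
    case False
    then obtain y0 where y0: "\<forall>i\<in>I. dot X y0 (a i) \<le> 0" "dot X y0 b > 0" by force
    have pos: "dot X y0 (a k) > 0"
      using insert.prems[of y0] y0 by force
    define y' where "y' = (\<lambda>x. inverse (dot X y0 (a k)) * y0 x)"
    have y': "dot X y' v = inverse (dot X y0 (a k)) * dot X y0 v" for v
      unfolding y'_def by (rule dot_scale_left)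
    have y'I: "\<forall>i\<in>I. dot X y' (a i) \<le> 0" and y'b: "dot X y' b > 0" and y'k: "dot X y' (a k) = 1"
      using y0 pos by (auto simp: y' mult_le_0_iff)
    define p where "p v = (\<lambda>x. v x + (- dot X y' v) * a k x)" for v
    \<comment> \<open>The projection moves from \<open>v\<close> to \<open>y\<close>. The projected
      \<open>y\<close> annihilates \<open>a k\<close>, so the hypothesis for
      \<open>insert k I\<close> applies to it.\<close>
    have p: "dot X y (p v) = dot X (\<lambda>x. y x + (- dot X y (a k)) * y' x) v" for y v
      unfolding p_def by (simp only: dot_add_scale_left dot_add_scale_right) simp
    have "dot X y (p b) \<le> 0" if "\<forall>i\<in>I. dot X y (p (a i)) \<le> 0" for y
    proof -
      have "dot X (\<lambda>x. y x + (- dot X y (a k)) * y' x) (a k) = 0"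
        by (simp add: dot_add_scale_left y'k del: mult_minus_left)
      then show ?thesis using that insert.prems unfolding p by simp
    qed
    then obtain u where u: "\<forall>i\<in>I. 0 \<le> u i" "\<forall>x\<in>X. p b x = (\<Sum>i\<in>I. u i * p (a i) x)"
      using insert.IH[of "\<lambda>i. p (a i)" "p b"] by blast
    \<comment> \<open>Undoing the projection gathers all multiples of \<open>a k\<close> in
      \<open>c\<close>, which is nonnegative because \<open>y'\<close> is positive on
      \<open>b\<close> and nonpositive on every \<open>a i\<close>.\<close>
    define c where "c = dot X y' b - (\<Sum>i\<in>I. u i * dot X y' (a i))"
    have "(\<Sum>i\<in>I. u i * dot X y' (a i)) \<le> 0"
      using u(1) y'I by (intro sum_nonpos) (simp add: mult_nonneg_nonpos)
    then have c: "c \<ge> 0" using y'b by (simp add: c_def)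
    have b: "b x = (\<Sum>i\<in>I. u i * a i x) + c * a k x" if "x \<in> X" for x
    proof -
      have "b x - dot X y' b * a k x = (\<Sum>i\<in>I. u i * (a i x - dot X y' (a i) * a k x))"
        using u(2) that by (simp add: p_def)
      also have "\<dots> = (\<Sum>i\<in>I. u i * a i x) - (\<Sum>i\<in>I. u i * dot X y' (a i)) * a k x"
        by (simp add: algebra_simps sum_subtractf sum_distrib_left)
      finally show ?thesis by (simp add: c_def algebra_simps)
    qed
    have "(\<Sum>i\<in>I. (u(k := c)) i * a i x) = (\<Sum>i\<in>I. u i * a i x)" for x
      using insert.hyps by (intro sum.cong) auto
    then show ?thesis
      using u(1) b c insert.hyps by (intro exI[of _ "u(k := c)"]) auto
  qed
qed

section \<open>Linear independence and the choice of one vector per coordinate\<close>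

text \<open>The hypothesis says that the vectors \<open>v b\<close> together with the unit vectors of \<open>Z\<close> are linearly
  independent, expressed by dual vectors.\<close>

lemma independent_transversal:
  assumes "finite B"
    and "\<And>b. b \<in> B \<Longrightarrow> \<exists>z. (\<forall>x\<in>Z. z x = 0) \<and> (\<forall>c\<in>B - {b}. dot X z (v c) = 0) \<and> dot X z (v b) \<noteq> 0"
  shows "\<exists>g. inj_on g B \<and> (\<forall>b\<in>B. g b \<in> X - Z \<and> v b (g b) \<noteq> 0)"
  using assms
proof (induction B arbitrary: Z rule: finite_induct)
  case empty
  then show ?case by simp
next
  case (insert b B)
  obtain z where z: "\<forall>x\<in>Z. z x = 0" "\<forall>c\<in>B. dot X z (v c) = 0" "dot X z (v b) \<noteq> 0"
    using insert.prems[of b] insert.hyps by auto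
  then obtain x where x: "x \<in> X" "z x \<noteq> 0" "v b x \<noteq> 0"
    unfolding dot_def by (metis (mono_tags, lifting) mult_eq_0_iff sum.neutral)
  have "\<exists>w. (\<forall>t\<in>insert x Z. w t = 0) \<and> (\<forall>e\<in>B - {c}. dot X w (v e) = 0) \<and> dot X w (v c) \<noteq> 0"
    if c: "c \<in> B" for c
  proof -
    obtain u where u: "\<forall>t\<in>Z. u t = 0" "\<forall>e\<in>insert b B - {c}. dot X u (v e) = 0" "dot X u (v c) \<noteq> 0"
      using insert.prems[of c] c by auto
    \<comment> \<open>With this \<open>q\<close>, \<open>u + q z\<close> vanishes at
      \<open>x\<close> too. Since \<open>z\<close> is zero on \<open>Z\<close> and orthogonal to the
      vectors of \<open>B\<close>, it stays a dual vector for \<open>c\<close>, and \<open>x\<close>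
      joins the forbidden coordinates.\<close>
    define q where "q = - u x / z x"
    have "u x + q * z x = 0" using x by (simp add: q_def)
    then show ?thesis
      using u z c by (intro exI[of _ "\<lambda>t. u t + q * z t"]) (simp add: dot_add_scale_left)
  qed
  then obtain g where g: "inj_on g B" "\<forall>c\<in>B. g c \<in> X - insert x Z \<and> v c (g c) \<noteq> 0"
    using insert.IH[of "insert x Z"] by blast
  have "x \<notin> Z" using x z by auto
  then have "inj_on (g(b := x)) (insert b B) \<and>
      (\<forall>c\<in>insert b B. (g(b := x)) c \<in> X - Z \<and> v c ((g(b := x)) c) \<noteq> 0)"
    using g x insert.hyps by (auto simp: inj_on_def)
  then show ?case by blast
qed

text \<open>In a \<open>B\<close> of least cardinality, an element without a dual vector could be
  dropped without losing any equation.\<close>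

lemma exists_minimal_orthogonal:
  assumes "finite T"
  shows "\<exists>B\<subseteq>T. (\<forall>z. (\<forall>b\<in>B. dot X z (v b) = 0) \<longrightarrow> (\<forall>t\<in>T. dot X z (v t) = 0)) \<and>
    (\<forall>b\<in>B. \<exists>z. (\<forall>c\<in>B - {b}. dot X z (v c) = 0) \<and> dot X z (v b) \<noteq> 0)"
proof -
  define P where "P B \<longleftrightarrow> B \<subseteq> T \<and> (\<forall>z. (\<forall>b\<in>B. dot X z (v b) = 0) \<longrightarrow> (\<forall>t\<in>T. dot X z (v t) = 0))" for B
  have "P T" by (simp add: P_def)
  from ex_has_least_nat[of P, OF this, of card]
  obtain B where B: "P B" "\<And>C. P C \<Longrightarrow> card B \<le> card C" by blast
  have fin: "finite B" using B(1) assms finite_subset by (auto simp: P_def)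
  have "\<exists>z. (\<forall>c\<in>B - {b}. dot X z (v c) = 0) \<and> dot X z (v b) \<noteq> 0" if b: "b \<in> B" for b
  proof (rule ccontr)
    assume "\<not> ?thesis"
    then have "P (B - {b})" using B(1) unfolding P_def by blast
    from B(2)[OF this] show False using b fin card_Diff1_less[of B b] by simp
  qed
  then show ?thesis using B(1) unfolding P_def by blast
qed

text \<open>Independence lets \<open>g\<close> place a minimal \<open>B\<close> at distinct
  coordinates. There \<open>f\<close> inverts \<open>g\<close>, so its values include all of
  \<open>B\<close>; elsewhere \<open>ne\<close> supplies an arbitrary filler.\<close>

lemma spanning_choice:
  assumes "finite T"
    and ne: "\<And>x. x \<in> X \<Longrightarrow> \<exists>t\<in>T. v t x \<noteq> 0"
  shows "\<exists>f. (\<forall>x\<in>X. f x \<in> T \<and> v (f x) x \<noteq> 0) \<and>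
    (\<forall>z. (\<forall>x\<in>X. dot X z (v (f x)) = 0) \<longrightarrow> (\<forall>t\<in>T. dot X z (v t) = 0))"
proof -
  obtain B where B: "B \<subseteq> T" "\<forall>z. (\<forall>b\<in>B. dot X z (v b) = 0) \<longrightarrow> (\<forall>t\<in>T. dot X z (v t) = 0)"
      "\<forall>b\<in>B. \<exists>z. (\<forall>c\<in>B - {b}. dot X z (v c) = 0) \<and> dot X z (v b) \<noteq> 0"
    using exists_minimal_orthogonal[OF assms(1)] by metis
  have "finite B" using B(1) assms(1) finite_subset by blast
  then obtain g where g: "inj_on g B" "\<forall>b\<in>B. g b \<in> X \<and> v b (g b) \<noteq> 0"
    using independent_transversal[of B "{}" X v] B(3) by auto
  obtain h where h: "\<And>x. x \<in> X \<Longrightarrow> h x \<in> T \<and> v (h x) x \<noteq> 0"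
    using ne by metis
  define f where "f x = (if x \<in> g ` B then inv_into B g x else h x)" for x
  have fg: "f (g b) = b" if "b \<in> B" for b
    using that g(1) by (simp add: f_def)
  have "f x \<in> T \<and> v (f x) x \<noteq> 0" if "x \<in> X" for x
  proof (cases "x \<in> g ` B")
    case True
    then show ?thesis using fg g(2) B(1) by auto
  next
    case False
    then show ?thesis using h[OF that] by (simp add: f_def)
  qed
  moreover have "\<forall>t\<in>T. dot X z (v t) = 0" if "\<forall>x\<in>X. dot X z (v (f x)) = 0" for z
    using that fg g(2) B(2) by metis
  ultimately show ?thesis by blast
qed

section \<open>Certificates as the dual of polydiagonals\<close>

definition grid :: "nat \<Rightarrow> nat \<Rightarrow> (nat \<times> nat) set" where
  "grid d n = {..<d} \<times> {..<n}"

text \<open>A pair \<open>x = (i, j)\<close> stands for a hyperplane. For \<alpha> in the index set,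
  \<open>dot (grid d n) z (incidence \<alpha>)\<close> is the sum of
  \<open>z (i, \<alpha> i)\<close> over all directions.\<close>

definition incidence :: "(nat \<Rightarrow> nat) \<Rightarrow> nat \<times> nat \<Rightarrow> real" where
  "incidence \<alpha> x = (if \<alpha> (fst x) = snd x then 1 else 0)"

definition certificate :: "nat \<Rightarrow> nat \<Rightarrow> (nat \<Rightarrow> nat) set \<Rightarrow> (nat \<times> nat \<Rightarrow> real) \<Rightarrow> bool" where
  "certificate d n S z \<longleftrightarrow>
     (\<forall>\<alpha>\<in>S. dot (grid d n) z (incidence \<alpha>) \<le> 0) \<and> 0 < sum z (grid d n)"

lemma finite_grid [simp]: "finite (grid d n)"
  by (simp add: grid_def)

lemma finite_supp [simp]: "finite (supp d n A)"
  by (simp add: supp_def index_set_def finite_PiE)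

lemma sum_hyperplane_supp:
  "(\<Sum>\<alpha>\<in>hyperplane d n i j \<inter> supp d n A. w \<alpha>) = (\<Sum>\<alpha>\<in>supp d n A. w \<alpha> * incidence \<alpha> (i, j))"
proof -
  have "hyperplane d n i j \<inter> supp d n A = {\<alpha> \<in> supp d n A. \<alpha> i = j}"
    by (auto simp: hyperplane_def supp_def)
  then show ?thesis
    by (simp add: incidence_def sum.inter_filter if_distrib cong: if_cong)
qed

lemma polydiagonal_iff:
  "polydiagonal d n A w \<longleftrightarrow> (\<forall>\<alpha>\<in>supp d n A. 0 \<le> w \<alpha>) \<and>
     (\<forall>x\<in>grid d n. (\<Sum>\<alpha>\<in>supp d n A. w \<alpha> * incidence \<alpha> x) = 1)"
  by (auto simp: polydiagonal_def sum_hyperplane_supp grid_def)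

text \<open>A polydiagonal writes the all-ones vector as a nonnegative combination of incidence
  vectors. Pairing this with \<open>z\<close> excludes certificates; the converse is Farkas'
  lemma.\<close>

lemma has_polydiagonal_iff: "has_polydiagonal d n A \<longleftrightarrow> (\<nexists>z. certificate d n (supp d n A) z)"
proof
  assume "has_polydiagonal d n A"
  then obtain w where w: "\<forall>\<alpha>\<in>supp d n A. 0 \<le> w \<alpha>"
      "\<forall>x\<in>grid d n. (\<Sum>\<alpha>\<in>supp d n A. w \<alpha> * incidence \<alpha> x) = 1"
    by (auto simp: has_polydiagonal_def polydiagonal_iff)
  have "sum z (grid d n) \<le> 0" if "\<forall>\<alpha>\<in>supp d n A. dot (grid d n) z (incidence \<alpha>) \<le> 0" for z
  proof -
    have "sum z (grid d n) = dot (grid d n) z (\<lambda>x. \<Sum>\<alpha>\<in>supp d n A. w \<alpha> * incidence \<alpha> x)"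
      using w(2) by (simp add: dot_def)
    also have "\<dots> = (\<Sum>\<alpha>\<in>supp d n A. w \<alpha> * dot (grid d n) z (incidence \<alpha>))"
      by (rule dot_sum_right)
    also have "\<dots> \<le> 0" using w(1) that by (intro sum_nonpos) (simp add: mult_nonneg_nonpos)
    finally show ?thesis .
  qed
  then show "\<nexists>z. certificate d n (supp d n A) z" by (force simp: certificate_def)
next
  assume "\<nexists>z. certificate d n (supp d n A) z"
  then have "dot (grid d n) y (\<lambda>_. 1) \<le> 0"
    if "\<forall>\<alpha>\<in>supp d n A. dot (grid d n) y (incidence \<alpha>) \<le> 0" for y
    using that by (force simp: certificate_def dot_def)
  then obtain u where "\<forall>\<alpha>\<in>supp d n A. 0 \<le> u \<alpha>"
      "\<forall>x\<in>grid d n. 1 = (\<Sum>\<alpha>\<in>supp d n A. u \<alpha> * incidence \<alpha> x)"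
    using farkas[of "supp d n A" "grid d n" incidence "\<lambda>_. 1"] by auto
  then show "has_polydiagonal d n A"
    by (auto simp: has_polydiagonal_def polydiagonal_iff intro!: exI[of _ u])
qed

text \<open>If \<open>z\<close> were nonpositive at an index off the support, it would remain a
  certificate after adding that index, against extremality.\<close>

lemma certificate_determines_supp:
  assumes A: "A \<in> extremal_matrices d n" and z: "certificate d n (supp d n A) z"
  shows "supp d n A = {\<alpha> \<in> index_set d n. dot (grid d n) z (incidence \<alpha>) \<le> 0}"
proof (intro equalityI subsetI)
  fix \<alpha> assume "\<alpha> \<in> supp d n A"
  then show "\<alpha> \<in> {\<alpha> \<in> index_set d n. dot (grid d n) z (incidence \<alpha>) \<le> 0}"
    using z by (auto simp: certificate_def supp_def)
next
  fix \<alpha> assume \<alpha>: "\<alpha> \<in> {\<alpha> \<in> index_set d n. dot (grid d n) z (incidence \<alpha>) \<le> 0}"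
  show "\<alpha> \<in> supp d n A"
  proof (rule ccontr)
    assume "\<alpha> \<notin> supp d n A"
    then have "has_polydiagonal d n (A(\<alpha> := 1))"
      using A \<alpha> by (auto simp: extremal_matrices_def)
    moreover have "supp d n (A(\<alpha> := 1)) = insert \<alpha> (supp d n A)"
      using \<alpha> by (auto simp: supp_def)
    moreover have "certificate d n (insert \<alpha> (supp d n A)) z"
      using z \<alpha> by (auto simp: certificate_def)
    ultimately show False by (auto simp: has_polydiagonal_iff)
  qed
qed

lemma zero_one_matrix_eqI:
  assumes A: "A \<in> zero_one_matrices d n" and B: "B \<in> zero_one_matrices d n"
    and eq: "supp d n A = supp d n B"
  shows "A = B"
proof (rule PiE_ext)
  show "A \<in> index_set d n \<rightarrow>\<^sub>E {0, 1}" "B \<in> index_set d n \<rightarrow>\<^sub>E {0, 1}"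
    using A B by (simp_all add: zero_one_matrices_def)
  fix \<alpha> assume \<alpha>: "\<alpha> \<in> index_set d n"
  then have "A \<alpha> \<in> {0, 1}" "B \<alpha> \<in> {0, 1}" using A B by (auto simp: zero_one_matrices_def)
  moreover have "A \<alpha> = 1 \<longleftrightarrow> B \<alpha> = 1" using eq \<alpha> unfolding supp_def by blast
  ultimately show "A \<alpha> = B \<alpha>" by auto
qed

section \<open>Maximal sets of tight indices\<close>

lemma exists_rigid_tight_set:
  assumes S: "finite S" and ex: "certificate d n S y0"
  shows "\<exists>T\<subseteq>S. \<exists>y. certificate d n S y \<and> (\<forall>\<alpha>\<in>T. dot (grid d n) y (incidence \<alpha>) = 0) \<and>
    (\<forall>z. (\<forall>\<alpha>\<in>T. dot (grid d n) z (incidence \<alpha>) = 0) \<and> 0 < sum z (grid d n) \<longrightarrow> certificate d n S z)"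
proof -
  let ?D = "\<lambda>z \<alpha>. dot (grid d n) z (incidence \<alpha>)"
  define tight where "tight y = {\<alpha> \<in> S. ?D y \<alpha> = 0}" for y
  have "card (tight y) < Suc (card S)" for y
    using card_mono[OF S, of "tight y"] by (auto simp: tight_def)
  then obtain y where y: "certificate d n S y"
    and max: "\<And>y'. certificate d n S y' \<Longrightarrow> card (tight y') \<le> card (tight y)"
    using ex_has_greatest_nat[of "certificate d n S", OF ex, of "\<lambda>y. card (tight y)" "Suc (card S)"]
    by (auto intro: less_imp_le)
  have "certificate d n S z" if z0: "\<forall>\<alpha>\<in>tight y. ?D z \<alpha> = 0" and zpos: "0 < sum z (grid d n)" for z
  proof (rule ccontr)
    assume "\<not> certificate d n S z"
    define P where "P = {\<alpha> \<in> S. ?D z \<alpha> > 0}"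
    have P: "finite P" "P \<noteq> {}"
      using S \<open>\<not> certificate d n S z\<close> zpos by (auto simp: P_def certificate_def not_le)
    \<comment> \<open>\<open>r \<alpha>\<close> is the step length along \<open>z\<close> at which
      \<alpha> becomes tight. Stopping at the first such index, \<beta>, violates no
      inequality.\<close>
    define r where "r \<alpha> = - ?D y \<alpha> / ?D z \<alpha>" for \<alpha>
    obtain \<beta> where \<beta>: "\<beta> \<in> P" "\<And>\<alpha>. \<alpha> \<in> P \<Longrightarrow> r \<beta> \<le> r \<alpha>"
      using arg_min_if_finite[OF P, of r] by (meson not_le)
    have yS: "?D y \<alpha> \<le> 0" if "\<alpha> \<in> S" for \<alpha> using y that by (auto simp: certificate_def)
    have r0: "r \<beta> \<ge> 0" using \<beta>(1) yS[of \<beta>] by (auto simp: r_def P_def field_simps)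
    define y' where "y' x = y x + r \<beta> * z x" for x
    have D: "?D y' \<alpha> = ?D y \<alpha> + r \<beta> * ?D z \<alpha>" for \<alpha>
      unfolding y'_def by (rule dot_add_scale_left)
    have "?D y' \<alpha> \<le> 0" if "\<alpha> \<in> S" for \<alpha>
    proof (cases "\<alpha> \<in> P")
      case True
      then show ?thesis using \<beta>(2)[OF True] by (auto simp: D r_def[of \<alpha>] P_def field_simps)
    next
      case False
      then have "r \<beta> * ?D z \<alpha> \<le> 0" using that r0 by (simp add: P_def mult_nonneg_nonpos)
      then show ?thesis using yS[OF that] by (simp add: D)
    qed
    moreover have "sum y' (grid d n) = sum y (grid d n) + r \<beta> * sum z (grid d n)"
      by (simp add: y'_def sum.distrib sum_distrib_left)
    then have "0 < sum y' (grid d n)"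
      using y r0 zpos by (simp add: certificate_def add_pos_nonneg)
    ultimately have "certificate d n S y'" by (simp add: certificate_def)
    then have le: "card (tight y') \<le> card (tight y)" by (rule max)
    have "\<beta> \<in> tight y'" using \<beta>(1) by (simp add: tight_def D r_def P_def)
    moreover have "\<beta> \<notin> tight y" using \<beta>(1) z0 by (auto simp: P_def)
    moreover have "tight y \<subseteq> tight y'" using z0 by (auto simp: tight_def D)
    ultimately have "card (tight y) < card (tight y')"
      using S by (intro psubset_card_mono) (auto simp: tight_def)
    then show False using le by simp
  qed
  then show ?thesis
    using y by (intro exI[of _ "tight y"] conjI exI[of _ y]) (auto simp: tight_def)
qed

section \<open>Encoding by one index per hyperplane\<close>

definition covers_hyperplanes :: "nat \<Rightarrow> nat \<Rightarrow> (nat \<Rightarrow> nat) set \<Rightarrow> bool" where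
  "covers_hyperplanes d n S \<longleftrightarrow> (\<forall>i<d. \<forall>j<n. S \<inter> hyperplane d n i j \<noteq> {})"

text \<open>The first conjunct keeps the second one from being vacuous.\<close>

definition codes :: "nat \<Rightarrow> nat \<Rightarrow> ((nat \<Rightarrow> nat) \<Rightarrow> nat) \<Rightarrow> (nat \<times> nat \<Rightarrow> nat \<Rightarrow> nat) \<Rightarrow> bool" where
  "codes d n A f \<longleftrightarrow>
     (\<exists>y. (\<forall>x\<in>grid d n. dot (grid d n) y (incidence (f x)) = 0) \<and> 0 < sum y (grid d n)) \<and>
     (\<forall>z. (\<forall>x\<in>grid d n. dot (grid d n) z (incidence (f x)) = 0) \<and> 0 < sum z (grid d n) \<longrightarrow>
        certificate d n (supp d n A) z)"

lemma exists_code: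
  assumes A: "A \<in> extremal_matrices d n" and cov: "covers_hyperplanes d n (supp d n A)"
  shows "\<exists>f\<in>(\<Pi>\<^sub>E x\<in>grid d n. hyperplane d n (fst x) (snd x)). codes d n A f"
proof -
  let ?X = "grid d n"
  let ?D = "\<lambda>z \<alpha>. dot (grid d n) z (incidence \<alpha>)"
  have "\<exists>y0. certificate d n (supp d n A) y0"
    using A by (auto simp: extremal_matrices_def has_polydiagonal_iff)
  then obtain T y where T: "T \<subseteq> supp d n A" and y: "certificate d n (supp d n A) y" "\<forall>\<alpha>\<in>T. ?D y \<alpha> = 0"
    and rigid: "\<And>z. \<forall>\<alpha>\<in>T. ?D z \<alpha> = 0 \<Longrightarrow> 0 < sum z ?X \<Longrightarrow> certificate d n (supp d n A) z"
    using exists_rigid_tight_set[OF finite_supp] by metis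
  \<comment> \<open>If \<open>T\<close> missed the hyperplane \<open>x\<close>, the unit vector at
    \<open>x\<close> would be a certificate by rigidity, yet it is 1 at a support index on
    \<open>x\<close> given by \<open>cov\<close>.\<close>
  have meets: "\<exists>\<alpha>\<in>T. incidence \<alpha> x \<noteq> 0" if x: "x \<in> ?X" for x
  proof (rule ccontr)
    assume none: "\<not> ?thesis"
    let ?e = "\<lambda>t. if t = x then 1 else 0 :: real"
    have e: "?D ?e \<alpha> = incidence \<alpha> x" for \<alpha>
      using x by (simp add: dot_unit)
    have "sum ?e ?X = 1" using x by simp
    then have "certificate d n (supp d n A) ?e"
      using none by (intro rigid) (simp_all add: e)
    moreover obtain \<alpha> where "\<alpha> \<in> supp d n A" "\<alpha> (fst x) = snd x"
      using cov x by (fastforce simp: covers_hyperplanes_def hyperplane_def grid_def)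
    ultimately show False by (force simp: certificate_def e incidence_def)
  qed
  have "finite T" using T finite_subset[OF _ finite_supp] by blast
  then obtain f where f: "\<forall>x\<in>?X. f x \<in> T \<and> incidence (f x) x \<noteq> 0"
      "\<forall>z. (\<forall>x\<in>?X. ?D z (f x) = 0) \<longrightarrow> (\<forall>\<alpha>\<in>T. ?D z \<alpha> = 0)"
    using spanning_choice[of T ?X incidence] meets by auto
  \<comment> \<open>Restriction gives membership in the extensional product to be counted;
    \<open>incidence (f x) x \<noteq> 0\<close> puts \<open>f x\<close> on the hyperplane
    \<open>x\<close>.\<close>
  define f' where "f' = restrict f ?X"
  have "f' \<in> (\<Pi>\<^sub>E x\<in>?X. hyperplane d n (fst x) (snd x))"
    using f(1) T by (auto simp: f'_def hyperplane_def supp_def incidence_def split: if_splits)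
  moreover have "codes d n A f'"
    unfolding codes_def
  proof (intro conjI allI impI)
    show "\<exists>y. (\<forall>x\<in>?X. ?D y (f' x) = 0) \<and> 0 < sum y ?X"
      using y f(1) by (intro exI[of _ y]) (auto simp: f'_def certificate_def)
    fix z assume z: "(\<forall>x\<in>?X. ?D z (f' x) = 0) \<and> 0 < sum z ?X"
    then have "\<forall>x\<in>?X. ?D z (f x) = 0" by (simp add: f'_def)
    then show "certificate d n (supp d n A) z" using f(2) z rigid by blast
  qed
  ultimately show ?thesis by blast
qed

text \<open>A vector \<open>y\<close> solving the equations of \<open>f\<close> is a certificate for
  both matrices, so both supports are read off from it.\<close>

lemma codes_unique:
  assumes "A \<in> extremal_matrices d n" "B \<in> extremal_matrices d n" "codes d n A f" "codes d n B f"
  shows "A = B"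
proof -
  obtain y where y: "certificate d n (supp d n A) y" "certificate d n (supp d n B) y"
    using assms(3,4) unfolding codes_def by blast
  have "supp d n A = supp d n B"
    by (rule trans[OF certificate_determines_supp[OF assms(1) y(1)]
          certificate_determines_supp[OF assms(2) y(2), symmetric]])
  then show ?thesis
    using assms(1,2) by (intro zero_one_matrix_eqI) (auto simp: extremal_matrices_def)
qed

section \<open>Counting the codes\<close>

lemma card_hyperplane:
  assumes "i < d" "j < n"
  shows "card (hyperplane d n i j) = n ^ (d - 1)"
proof -
  have "hyperplane d n i j = (\<Pi>\<^sub>E k\<in>{..<d}. if k = i then {j} else {..<n})"
  proof (intro equalityI subsetI)
    fix \<alpha> assume "\<alpha> \<in> hyperplane d n i j"
    then show "\<alpha> \<in> (\<Pi>\<^sub>E k\<in>{..<d}. if k = i then {j} else {..<n})"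
      by (simp add: hyperplane_def index_set_def PiE_iff)
  next
    fix \<alpha> assume "\<alpha> \<in> (\<Pi>\<^sub>E k\<in>{..<d}. if k = i then {j} else {..<n})"
    then have ext: "\<alpha> \<in> extensional {..<d}"
      and mem: "\<And>k. k < d \<Longrightarrow> \<alpha> k \<in> (if k = i then {j} else {..<n})"
      by (simp_all add: PiE_iff)
    have "\<alpha> i = j" using mem[OF assms(1)] by simp
    moreover have "\<alpha> k < n" if "k < d" for k
      using mem[OF that] assms(2) by (cases "k = i") simp_all
    ultimately show "\<alpha> \<in> hyperplane d n i j"
      using ext by (simp add: hyperplane_def index_set_def PiE_iff)
  qed
  then have "card (hyperplane d n i j) = (\<Prod>k<d. card (if k = i then {j} else {..<n}))"
    by (simp add: card_PiE)
  also have "\<dots> = (\<Prod>k\<in>{..<d} - {i}. n)"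
    using assms by (subst prod.remove[of _ i]) auto
  finally show ?thesis using assms by simp
qed

lemma card_hyperplane_choices:
  "card (\<Pi>\<^sub>E x\<in>grid d n. hyperplane d n (fst x) (snd x)) = n ^ (n * d * (d - 1))"
proof -
  have "card (\<Pi>\<^sub>E x\<in>grid d n. hyperplane d n (fst x) (snd x)) = (\<Prod>x\<in>grid d n. n ^ (d - 1))"
    unfolding card_PiE[OF finite_grid]
    by (intro prod.cong) (auto simp: card_hyperplane grid_def)
  also have "\<dots> = (n ^ (d - 1)) ^ (d * n)" by (simp add: grid_def)
  also have "\<dots> = n ^ ((d - 1) * (d * n))" by (rule power_mult[symmetric])
  also have "(d - 1) * (d * n) = n * d * (d - 1)" by (simp only: mult_ac)
  finally show ?thesis .
qed

lemma card_covering_extremal: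
  "card {A \<in> extremal_matrices d n. covers_hyperplanes d n (supp d n A)} \<le> n ^ (n * d * (d - 1))"
proof -
  let ?E = "{A \<in> extremal_matrices d n. covers_hyperplanes d n (supp d n A)}"
  let ?F = "\<Pi>\<^sub>E x\<in>grid d n. hyperplane d n (fst x) (snd x)"
  have "\<forall>A\<in>?E. \<exists>f. f \<in> ?F \<and> codes d n A f" using exists_code by blast
  then obtain h where h: "\<forall>A\<in>?E. h A \<in> ?F \<and> codes d n A (h A)" by (rule bchoice[THEN exE])
  have "inj_on h ?E"
  proof (rule inj_onI)
    fix A B assume AB: "A \<in> ?E" "B \<in> ?E" and eq: "h A = h B"
    have "codes d n A (h A)" "codes d n B (h A)"
      using bspec[OF h AB(1)] bspec[OF h AB(2)] eq by simp_all
    then show "A = B" using AB codes_unique[of A d n B "h A"] by simp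
  qed
  moreover have "finite ?F"
    by (rule finite_PiE) (simp_all add: hyperplane_def index_set_def finite_PiE)
  ultimately have "card ?E \<le> card ?F"
    using h by (intro card_inj_on_le[of h] image_subsetI) blast+
  then show ?thesis by (simp only: card_hyperplane_choices)
qed

section \<open>Supports avoiding a hyperplane\<close>

text \<open>The unit vector at \<open>(i, j)\<close> is a certificate here, and it determines the
  support.\<close>

lemma supp_of_avoided_hyperplane:
  assumes A: "A \<in> extremal_matrices d n" and ij: "i < d" "j < n"
    and avoid: "supp d n A \<inter> hyperplane d n i j = {}"
  shows "supp d n A = {\<alpha> \<in> index_set d n. \<alpha> i \<noteq> j}"
proof -
  let ?e = "\<lambda>t. if t = (i, j) then 1 else 0 :: real"
  have mem: "(i, j) \<in> grid d n" using ij by (simp add: grid_def)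
  have e: "dot (grid d n) ?e (incidence \<alpha>) = incidence \<alpha> (i, j)" for \<alpha>
    using mem by (simp add: dot_unit)
  have "sum ?e (grid d n) = 1" using mem by simp
  then have "certificate d n (supp d n A) ?e"
    using avoid by (auto simp: certificate_def e incidence_def hyperplane_def supp_def)
  from certificate_determines_supp[OF A this] show ?thesis
    by (auto simp: e incidence_def)
qed

lemma zero_hyperplane_matrices_equiv:
  assumes A: "A \<in> zero_one_matrices d n" and B: "B \<in> zero_one_matrices d n"
    and ij: "i < d" "j < n" "i' < d" "j' < n"
    and sA: "supp d n A = {\<alpha> \<in> index_set d n. \<alpha> i \<noteq> j}"
    and sB: "supp d n B = {\<alpha> \<in> index_set d n. \<alpha> i' \<noteq> j'}"
  shows "(A, B) \<in> matrix_equiv d n"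
proof -
  define \<tau> where "\<tau> = transpose i i'"
  \<comment> \<open>The same swap serves in every direction, since each support restricts only one
    coordinate.\<close>
  define \<sigma> :: "nat \<Rightarrow> nat \<Rightarrow> nat" where "\<sigma> = (\<lambda>_. transpose j j')"
  have \<tau>: "\<tau> permutes {..<d}" using ij by (auto simp: \<tau>_def intro: permutes_swap_id)
  have \<sigma>: "\<forall>k<d. \<sigma> k permutes {..<n}" using ij by (auto simp: \<sigma>_def intro: permutes_swap_id)
  have "B \<alpha> = A (act_index d \<tau> \<sigma> \<alpha>)" if \<alpha>: "\<alpha> \<in> index_set d n" for \<alpha>
  proof -
    let ?\<beta> = "act_index d \<tau> \<sigma> \<alpha>"
    have \<beta>: "?\<beta> \<in> index_set d n" by (rule act_index_in[OF \<tau> \<sigma> \<alpha>])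
    have "?\<beta> i = transpose j j' (\<alpha> i')" using ij by (simp add: act_index_def \<tau>_def \<sigma>_def)
    then have "?\<beta> i = j \<longleftrightarrow> \<alpha> i' = j'" by (auto simp: transpose_def)
    then have "\<alpha> \<in> supp d n B \<longleftrightarrow> ?\<beta> \<in> supp d n A" using \<alpha> \<beta> unfolding sA sB by simp
    then have "B \<alpha> = 1 \<longleftrightarrow> A ?\<beta> = 1" using \<alpha> \<beta> by (simp add: supp_def)
    moreover have "B \<alpha> \<in> {0, 1}" "A ?\<beta> \<in> {0, 1}"
      using A B \<alpha> \<beta> unfolding zero_one_matrices_def by blast+
    ultimately show ?thesis by auto
  qed
  then show ?thesis using A B \<tau> \<sigma> unfolding matrix_equiv_def by blast
qed

text \<open>Each such support is the complement of one hyperplane, so any two are equivalent. There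
  are none when \<open>d = 0\<close> or \<open>n = 0\<close>.\<close>

lemma card_noncovering_classes:
  "card ({A \<in> extremal_matrices d n. \<not> covers_hyperplanes d n (supp d n A)} // matrix_equiv d n) \<le> 1"
proof -
  let ?E = "{A \<in> extremal_matrices d n. \<not> covers_hyperplanes d n (supp d n A)}"
  have rel: "(A, B) \<in> matrix_equiv d n" if AB: "A \<in> ?E" "B \<in> ?E" for A B
  proof -
    obtain i j i' j' where "i < d" "j < n" "i' < d" "j' < n"
        "supp d n A = {\<alpha> \<in> index_set d n. \<alpha> i \<noteq> j}" "supp d n B = {\<alpha> \<in> index_set d n. \<alpha> i' \<noteq> j'}"
      using AB supp_of_avoided_hyperplane unfolding covers_hyperplanes_def by blast
    then show ?thesis
      using AB zero_hyperplane_matrices_equiv by (auto simp: extremal_matrices_def)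
  qed
  have "C = C'" if "C \<in> ?E // matrix_equiv d n" "C' \<in> ?E // matrix_equiv d n" for C C'
    using that rel equiv_class_eq[OF equiv_matrix_equiv] unfolding quotient_def by blast
  then have "\<forall>C\<in>?E // matrix_equiv d n. \<forall>C'\<in>?E // matrix_equiv d n. C = C'" by blast
  moreover have "finite (?E // matrix_equiv d n)"
    unfolding quotient_def using finite_extremal_matrices by auto
  ultimately show ?thesis by (simp add: card_le_Suc0_iff_eq)
qed

theorem corollary9:
  fixes d n :: nat
  shows "card (extremal_matrices d n // matrix_equiv d n) \<le> n ^ (n * d * (d - 1)) + 1"
proof -
  let ?R = "matrix_equiv d n"
  let ?E = "{A \<in> extremal_matrices d n. covers_hyperplanes d n (supp d n A)}"
  let ?E' = "{A \<in> extremal_matrices d n. \<not> covers_hyperplanes d n (supp d n A)}"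
  \<comment> \<open>Covering matrices are counted individually, which bounds their classes.\<close>
  have "?E // ?R = (\<lambda>A. ?R `` {A}) ` ?E" by (auto simp: quotient_def)
  then have "card (?E // ?R) \<le> card ?E"
    using finite_extremal_matrices by (simp add: card_image_le)
  then have "card (?E // ?R) \<le> n ^ (n * d * (d - 1))"
    using card_covering_extremal by (rule order_trans)
  moreover have "extremal_matrices d n // ?R = ?E // ?R \<union> ?E' // ?R"
    by (auto simp: quotient_def)
  then have "card (extremal_matrices d n // ?R) \<le> card (?E // ?R) + card (?E' // ?R)"
    by (simp only: card_Un_le)
  ultimately show ?thesis using card_noncovering_classes[of d n] by linarith
qed

end
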